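(* Let $N, n_x, n_+\ge 1$ be integers, $\alpha>0$, and let $\mathsf{A}^{(k)}\in\mathbb{R}^{n_+\times n_x}$, $b^{(k)}\in\mathbb{R}^{n_+}$ for $k=1,\dots,N$. Let $\sigma^\ast\in\mathbb{R}^{n_x}$ be the minimizer of $$\mathcal{J}(\sigma)=\frac1N\sum_{k=1}^N\left(\frac12\|\mathsf{A}^{(k)}\sigma-b^{(k)}\|_2^2+\frac{\alpha}{2}\|\sigma\|_2^2\right),\qquad \sigma\in\mathbb{R}^{n_x}.$$ Fix a deterministic initial guess $\sigma_0\in\mathbb{R}^{n_x}$ and, for a constant learning rate $\eta>0$, let $(\sigma_n)_{n\ge 0}$ be the stochastic gradient descent iterates $$\sigma_{n+1}=\sigma_n-\eta\left(\mathsf{A}^{(\gamma_n)\top}\mathsf{A}^{(\gamma_n)}\sigma_n-\mathsf{A}^{(\gamma_n)\top}b^{(\gamma_n)}+\alpha\sigma_n\right),$$ where $\gamma_0,\gamma_1,\dots$ are independent and uniformly distributed on $\{1,\dots,N\}$. Let $e_n=\sigma_n-\sigma^\ast$. Then there exist $\bar\eta>0$ and $C>0$, independent of $n$ and $\eta$, such that for all $0<\eta<\bar\eta$ and all $n\ge 0$, $$\mathrm{Cov}[e_n,e_n]\le C\,\eta,$$ i.e. $x^\top\,\mathrm{Cov}[e_n,e_n]\,x\le C\eta$ for every $x\in\mathbb{R}^{n_x}$ with $\|x\|_2=1$.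
   Context: $\|\cdot\|_2$ is the Euclidean norm of vectors. For random vectors $X,Y$, $\mathrm{Cov}[X,Y]=\mathbb{E}\left[(X-\mathbb{E}X)(Y-\mathbb{E}Y)^\top\right]$; expectations are over the random indices $\gamma_n$. The constants $\bar\eta$ and $C$ may depend on the data $\mathsf{A}^{(k)}, b^{(k)}$, $N$, $n_x$, $\alpha$ and $\sigma_0$. Origin of the data: the problem is the discretization of the linearized inverse problem for the radiative transfer equation, with $n_x$ grid points $x_n$ in the spatial domain and $n_+$ grid points $(x_{\ast,m},v_{\ast,m})$ on the outgoing boundary. $\mathsf{A}^{(k)}_{mn}=\beta^{(k)}(x_n,x_{\ast,m},v_{\ast,m})\Delta x_n$ discretizes the integral operator $\sigma\mapsto\int\beta^{(k)}\sigma\,dx$ whose kernel $\beta^{(k)}$ comes from the $k$-th experiment, $\Delta x_n$ is the volume represented by grid point $x_n$, $b^{(k)}$ is the vector of outgoing data of the $k$-th experiment minus the background prediction, and $\alpha$ is the regularization parameter. For the statement these are treated as given real matrices and vectors. *)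

theory Defs
  imports "HOL-Probability.Probability"
begin

definition objective ::
  "nat \<Rightarrow> (nat \<Rightarrow> real^'x^'p) \<Rightarrow> (nat \<Rightarrow> real^'p) \<Rightarrow> real \<Rightarrow> real^'x \<Rightarrow> real" where
  "objective N A b \<alpha> \<sigma> =
     (1 / real N) * (\<Sum>k=1..N. 1/2 * (norm (A k *v \<sigma> - b k))\<^sup>2 + \<alpha>/2 * (norm \<sigma>)\<^sup>2)"

text \<open>The SGD iterates along one fixed sequence \<open>g\<close> of selected indices.\<close>

primrec sgd ::
  "(nat \<Rightarrow> real^'x^'p) \<Rightarrow> (nat \<Rightarrow> real^'p) \<Rightarrow> real \<Rightarrow> real \<Rightarrow> real^'x \<Rightarrow> (nat \<Rightarrow> nat) \<Rightarrow> nat \<Rightarrow> real^'x" where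
  "sgd A b \<alpha> \<eta> \<sigma>0 g 0 = \<sigma>0"
| "sgd A b \<alpha> \<eta> \<sigma>0 g (Suc n) =
     (let \<sigma> = sgd A b \<alpha> \<eta> \<sigma>0 g n; k = g n in
        \<sigma> - \<eta> *\<^sub>R ((transpose (A k) ** A k) *v \<sigma> - transpose (A k) *v b k + \<alpha> *\<^sub>R \<sigma>))"

text \<open>Index variables take values in \<open>{1..N}\<close> on all of the sample space, not just almost surely.\<close>

definition iid_uniform_indices :: "'w measure \<Rightarrow> nat \<Rightarrow> (nat \<Rightarrow> 'w \<Rightarrow> nat) \<Rightarrow> bool" where
  "iid_uniform_indices M N \<gamma> \<longleftrightarrow>
     prob_space M \<and>
     prob_space.indep_vars M (\<lambda>_. count_space {1..N}) \<gamma> UNIV \<and>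
     (\<forall>n. distr M (count_space {1..N}) (\<gamma> n) = uniform_count_measure {1..N})"

text \<open>Both expectations are Bochner integrals, vector-valued and matrix-valued respectively;
  such an integral is \<open>0\<close> by convention when the integrand is not integrable.
  The annotations force the inner dimension of the product to be 1; \<open>columnvector\<close> and \<open>rowvector\<close>
  leave it polymorphic.\<close>

definition cov_matrix ::
  "'w measure \<Rightarrow> ('w \<Rightarrow> real^'i) \<Rightarrow> ('w \<Rightarrow> real^'j) \<Rightarrow> real^'j^'i" where
  "cov_matrix M X Y =
     (LINT \<omega>|M. (columnvector (X \<omega> - integral\<^sup>L M X) :: real^1^'i) **
                (rowvector (Y \<omega> - integral\<^sup>L M Y) :: real^'j^1))"

lemma columnvector_rowvector_nth:
  "((columnvector u :: real^1^'i) ** (rowvector v :: real^'j^1)) $ i $ j = u $ i * v $ j"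
  by (simp add: matrix_matrix_mult_def columnvector_def rowvector_def)

end

theory Submission
  imports Defs
begin

text \<open>
  Compare the iterates with the deterministic gradient descent \<open>c\<^sub>n\<close> for the averaged objective,
  started at the same point, not with the minimizer: the deviation \<open>d\<^sub>n = \<sigma>\<^sub>n - c\<^sub>n\<close> starts at \<open>0\<close>.
  All iterates stay in a ball of radius independent of \<open>\<eta>\<close> and \<open>n\<close>. One random step contracts
  \<open>\<parallel>d\<^sub>n\<parallel>\<^sup>2\<close> by \<open>1 - \<eta>\<alpha>\<close> and adds noise \<open>\<eta>\<zeta>\<^sub>k\<close> with \<open>\<Sum>\<^sub>k \<zeta>\<^sub>k = 0\<close>, so the terms of order \<open>\<eta>\<close>
  cancel in the mean and \<open>E \<parallel>d\<^sub>n\<parallel>\<^sup>2\<close> gains only \<open>O(\<eta>\<^sup>2)\<close> per step. Summing the geometric series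
  gives \<open>E \<parallel>d\<^sub>n\<parallel>\<^sup>2 = O(\<eta>)\<close>, which dominates the variance of \<open>x \<bullet> e\<^sub>n\<close> for every unit vector \<open>x\<close>.
\<close>

section \<open>Orbits of index-driven maps and bounded random vectors\<close>

primrec orbit :: "(nat \<Rightarrow> 'a \<Rightarrow> 'a) \<Rightarrow> 'a \<Rightarrow> (nat \<Rightarrow> nat) \<Rightarrow> nat \<Rightarrow> 'a" where
  "orbit T s g 0 = s"
| "orbit T s g (Suc n) = T (g n) (orbit T s g n)"

text \<open>Position \<open>n\<close> depends only on the indices before \<open>n\<close>. This is
  what later makes the current iterate independent of the index drawn at time
  \<open>n\<close>.\<close>

lemma orbit_cong: "(\<And>i. i < n \<Longrightarrow> g i = h i) \<Longrightarrow> orbit T s g n = orbit T s h n"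
  by (induction n) auto

text \<open>The coordinate set \<open>J\<close> stays free because two choices occur:
  \<open>UNIV\<close> for measurability on the sample space, and \<open>{..<n}\<close> for
  independence from coordinate \<open>n\<close>. The set \<open>K\<close>, being a set of naturals,
  is countable, so one can split by the value of the last index.\<close>

lemma orbit_measurable:
  fixes T :: "nat \<Rightarrow> 'a::topological_space \<Rightarrow> 'a"
  assumes T: "\<And>k. k \<in> K \<Longrightarrow> T k \<in> borel_measurable borel"
    and "{..<n} \<subseteq> J"
  shows "(\<lambda>g. orbit T s g n) \<in> borel_measurable (PiM J (\<lambda>_. count_space K))"
  using assms(2)
proof (induction n)
  case (Suc n)
  have IH: "(\<lambda>g. orbit T s g n) \<in> borel_measurable (PiM J (\<lambda>_. count_space K))"
    using Suc.prems by (intro Suc.IH) auto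
  have "(\<lambda>g. g n) \<in> measurable (PiM J (\<lambda>_. count_space K)) (count_space K)"
    using Suc.prems by (intro measurable_component_singleton) auto
  from measurable_compose_countable'[where f = "\<lambda>k g. T k (orbit T s g n)", OF measurable_compose[OF IH T] this]
  show ?case by simp
qed simp

text \<open>\<open>F\<close> is bounded on the compact ball that contains all values of
  \<open>X\<close>. Since the iterates are bounded at every sample point, this settles integrability
  of all the moments below.\<close>

lemma (in prob_space) integrable_continuous_of_bounded:
  fixes X :: "'a \<Rightarrow> 'b::euclidean_space" and F :: "'b \<Rightarrow> 'c::euclidean_space"
  assumes X: "X \<in> borel_measurable M"
    and bd: "\<And>\<omega>. \<omega> \<in> space M \<Longrightarrow> norm (X \<omega>) \<le> R"
    and F: "continuous_on UNIV F"
  shows "integrable M (\<lambda>\<omega>. F (X \<omega>))"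
proof -
  have "compact (F ` cball 0 R)"
    using F continuous_on_subset by (intro compact_continuous_image) auto
  then have "bounded (F ` cball 0 R)" by (rule compact_imp_bounded)
  then obtain B where "\<And>y. y \<in> cball 0 R \<Longrightarrow> norm (F y) \<le> B"
    unfolding bounded_iff by blast
  moreover have "(\<lambda>\<omega>. F (X \<omega>)) \<in> borel_measurable M"
    using borel_measurable_continuous_onI[OF F] X by (rule measurable_compose_rev)
  ultimately show ?thesis
    using bd by (intro integrable_const_bound[of _ B]) auto
qed

lemma (in prob_space) variance_le_second_moment:
  fixes Y :: "'a \<Rightarrow> real"
  assumes "integrable M Y" "integrable M (\<lambda>\<omega>. (Y \<omega>)\<^sup>2)"
  shows "expectation (\<lambda>\<omega>. (Y \<omega> - expectation Y)\<^sup>2) \<le> expectation (\<lambda>\<omega>. (Y \<omega>)\<^sup>2)"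
  using variance_eq[OF assms] by simp

section \<open>Averaging over one fresh uniform index\<close>

lemma iid_uniform_indices_measurable:
  "iid_uniform_indices M N \<gamma> \<Longrightarrow> \<gamma> n \<in> measurable M (count_space {1..N})"
  by (auto simp: iid_uniform_indices_def prob_space.indep_vars_def2 simp del: One_nat_def)

lemma iid_uniform_indices_range:
  "iid_uniform_indices M N \<gamma> \<Longrightarrow> \<omega> \<in> space M \<Longrightarrow> \<gamma> n \<omega> \<in> {1..N}"
  using measurable_space[OF iid_uniform_indices_measurable] by fastforce

lemma iid_uniform_indices_orbit_measurable:
  fixes T :: "nat \<Rightarrow> 'a::topological_space \<Rightarrow> 'a"
  assumes iid: "iid_uniform_indices M N \<gamma>"
    and T: "\<And>k. k \<in> {1..N} \<Longrightarrow> T k \<in> borel_measurable borel"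
  shows "(\<lambda>\<omega>. orbit T s (\<lambda>j. \<gamma> j \<omega>) n) \<in> borel_measurable M"
proof -
  have "(\<lambda>\<omega>. \<lambda>i\<in>UNIV. \<gamma> i \<omega>) \<in> measurable M (PiM UNIV (\<lambda>_. count_space {1..N}))"
    using iid_uniform_indices_measurable[OF iid] by (intro measurable_restrict) auto
  moreover have "(\<lambda>g. orbit T s g n) \<in> borel_measurable (PiM UNIV (\<lambda>_. count_space {1..N}))"
    using T by (rule orbit_measurable) auto
  ultimately have "(\<lambda>\<omega>. orbit T s (\<lambda>i\<in>UNIV. \<gamma> i \<omega>) n) \<in> borel_measurable M"
    by (rule measurable_compose)
  then show ?thesis by (simp add: restrict_def)
qed

text \<open>This replaces conditioning on the past: split by the value \<open>k\<close> of
  \<open>\<gamma> n\<close> with indicators. Each indicator has mean \<open>1 / real N\<close> and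
  is independent of the first \<open>n\<close> indices, hence of the iterate at time
  \<open>n\<close>, so every product expectation factors.\<close>

lemma expectation_orbit_Suc:
  fixes T :: "nat \<Rightarrow> 'a::topological_space \<Rightarrow> 'a" and F :: "'a \<Rightarrow> real"
  assumes iid: "iid_uniform_indices M N \<gamma>"
    and T: "\<And>k. k \<in> {1..N} \<Longrightarrow> T k \<in> borel_measurable borel"
    and F: "F \<in> borel_measurable borel"
    and int: "\<And>k. k \<in> {1..N} \<Longrightarrow> integrable M (\<lambda>\<omega>. F (T k (orbit T s (\<lambda>j. \<gamma> j \<omega>) n)))"
  shows "(LINT \<omega>|M. F (orbit T s (\<lambda>j. \<gamma> j \<omega>) (Suc n))) =
    (LINT \<omega>|M. (\<Sum>k=1..N. F (T k (orbit T s (\<lambda>j. \<gamma> j \<omega>) n))) / real N)"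
proof -
  interpret prob_space M using iid by (simp add: iid_uniform_indices_def)
  let ?C = "\<lambda>_::nat. count_space {1..N}"
  let ?S = "\<lambda>\<omega>. orbit T s (\<lambda>j. \<gamma> j \<omega>) n"
  let ?I = "\<lambda>k \<omega>. indicator {k} (\<gamma> n \<omega>) :: real"
  have ind: "indep_vars ?C \<gamma> UNIV"
    using iid by (simp add: iid_uniform_indices_def)
  have g: "\<gamma> n \<in> measurable M (count_space {1..N})"
    using iid by (rule iid_uniform_indices_measurable)
  have I_meas: "?I k \<in> borel_measurable M" for k
    using g by (rule measurable_compose) simp
  have I_int: "integrable M (?I k)" for k
    by (rule integrable_const_bound[of _ 1, OF _ I_meas]) auto
  have I_exp: "expectation (?I k) = 1 / real N" if "k \<in> {1..N}" for k
  proof -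
    have "expectation (?I k) = integral\<^sup>L (distr M (count_space {1..N}) (\<gamma> n)) (indicator {k})"
      by (subst integral_distr[OF g]) auto
    also have "\<dots> = measure (uniform_count_measure {1..N}) {k}"
      using iid that by (simp add: iid_uniform_indices_def)
    finally show ?thesis
      using that by (simp add: measure_uniform_count_measure)
  qed
  have indep: "indep_var borel (\<lambda>\<omega>. F (T k (?S \<omega>))) borel (?I k)" if k: "k \<in> {1..N}" for k
  proof -
    \<comment> \<open>The blocks \<open>{..<n}\<close> and \<open>{n}\<close> are disjoint, so the
      two subfamilies are independent; each factor is then written as a function of its own
      block.\<close>
    have "indep_var (PiM {..<n} ?C) (\<lambda>\<omega>. restrict (\<lambda>i. \<gamma> i \<omega>) {..<n})
                    (PiM {n} ?C) (\<lambda>\<omega>. restrict (\<lambda>i. \<gamma> i \<omega>) {n})"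
      by (rule indep_var_restrict[OF ind]) auto
    moreover have "(\<lambda>g. F (T k (orbit T s g n))) \<in> borel_measurable (PiM {..<n} ?C)"
    proof -
      have "(\<lambda>g. orbit T s g n) \<in> borel_measurable (PiM {..<n} ?C)"
        using T by (rule orbit_measurable) auto
      from measurable_compose[OF measurable_compose[OF this T[OF k]] F] show ?thesis .
    qed
    moreover have "(\<lambda>g. indicator {k} (g n) :: real) \<in> borel_measurable (PiM {n} ?C)"
      by (rule measurable_compose[OF measurable_component_singleton]) auto
    ultimately have "indep_var borel ((\<lambda>g. F (T k (orbit T s g n))) \<circ> (\<lambda>\<omega>. restrict (\<lambda>i. \<gamma> i \<omega>) {..<n}))
        borel ((\<lambda>g. indicator {k} (g n)) \<circ> (\<lambda>\<omega>. restrict (\<lambda>i. \<gamma> i \<omega>) {n}))"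
      by (rule indep_var_compose)
    moreover have "orbit T s (restrict (\<lambda>i. \<gamma> i \<omega>) {..<n}) n = ?S \<omega>" for \<omega>
      by (rule orbit_cong) simp
    ultimately show ?thesis
      by (simp add: comp_def)
  qed
  have "(LINT \<omega>|M. F (orbit T s (\<lambda>j. \<gamma> j \<omega>) (Suc n))) =
      (LINT \<omega>|M. (\<Sum>k=1..N. F (T k (?S \<omega>)) * ?I k \<omega>))"
  \<comment> \<open>\<open>\<gamma> n \<omega>\<close> lies in \<open>{1..N}\<close> at every sample
    point, so exactly one indicator in the sum equals 1.\<close>
  proof (rule Bochner_Integration.integral_cong[OF refl])
    fix \<omega> assume "\<omega> \<in> space M"
    then have "\<gamma> n \<omega> \<in> {1..N}"
      using measurable_space[OF g] by auto
    then show "F (orbit T s (\<lambda>j. \<gamma> j \<omega>) (Suc n)) = (\<Sum>k=1..N. F (T k (?S \<omega>)) * ?I k \<omega>)"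
      by (simp add: indicator_def if_distrib[of "(*) _"] sum.delta cong: if_cong)
  qed
  also have "\<dots> = (\<Sum>k=1..N. LINT \<omega>|M. F (T k (?S \<omega>)) * ?I k \<omega>)"
    using indep_var_integrable[OF indep int I_int]
    by (intro Bochner_Integration.integral_sum)
  also have "\<dots> = (\<Sum>k=1..N. (LINT \<omega>|M. F (T k (?S \<omega>))) * (1 / real N))"
    using indep_var_lebesgue_integral[OF indep int I_int] I_exp
    by (intro sum.cong) auto
  also have "\<dots> = (LINT \<omega>|M. (\<Sum>k=1..N. F (T k (?S \<omega>))) / real N)"
    using int by (simp add: Bochner_Integration.integral_sum sum_divide_distrib)
  finally show ?thesis .
qed

section \<open>One-step estimates for strongly monotone maps\<close>

lemma norm_add_scaleR_power2:
  fixes x y :: "'a::real_inner"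
  shows "(norm (x + t *\<^sub>R y))\<^sup>2 = (norm x)\<^sup>2 + 2 * t * (x \<bullet> y) + t\<^sup>2 * (norm y)\<^sup>2"
  unfolding power2_norm_eq_inner
  by (simp add: inner_add_left inner_add_right inner_commute[of y x] power2_eq_square algebra_simps)

text \<open>\<open>G k\<close> stands for the gradient of the \<open>k\<close>-th summand of the
  objective. The estimates use only these inequalities, not that the gradient is affine.\<close>

locale strongly_monotone_family =
  fixes N :: nat and G :: "nat \<Rightarrow> 'a::euclidean_space \<Rightarrow> 'a" and \<alpha> \<Lambda> g0 :: real
  assumes N_pos: "N \<ge> 1" and \<alpha>_pos: "\<alpha> > 0" and \<alpha>_le: "\<alpha> \<le> \<Lambda>"
    and strong_mono: "k \<in> {1..N} \<Longrightarrow> (G k u - G k v) \<bullet> (u - v) \<ge> \<alpha> * (norm (u - v))\<^sup>2"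
    and lipschitz: "k \<in> {1..N} \<Longrightarrow> norm (G k u - G k v) \<le> \<Lambda> * norm (u - v)"
    and bound_at_0: "k \<in> {1..N} \<Longrightarrow> norm (G k 0) \<le> g0"
begin

definition step :: "real \<Rightarrow> nat \<Rightarrow> 'a \<Rightarrow> 'a" where
  "step \<eta> k u = u - \<eta> *\<^sub>R G k u"

definition mean_field :: "'a \<Rightarrow> 'a" where
  "mean_field u = (\<Sum>k=1..N. G k u) /\<^sub>R real N"

definition mean_step :: "real \<Rightarrow> 'a \<Rightarrow> 'a" where
  "mean_step \<eta> u = u - \<eta> *\<^sub>R mean_field u"

text \<open>The term \<open>2 * g0 / \<alpha>\<close> ensures
  \<open>g0 \<le> \<alpha> / 2 * radius s\<close>: the shrinkage of a vector on the boundary of the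
  ball then outweighs the displacement, at most \<open>\<eta> * g0\<close>, of the origin in one
  step.\<close>

definition radius :: "'a \<Rightarrow> real" where
  "radius s = norm s + 2 * g0 / \<alpha>"

text \<open>Bounds \<open>mean_field c - G k c\<close> for \<open>c\<close> in the ball of radius
  \<open>R\<close>, where both terms have norm at most \<open>\<Lambda> * R + g0\<close>.\<close>

definition noise :: "real \<Rightarrow> real" where
  "noise R = 2 * (\<Lambda> * R + g0)"

text \<open>Collects the terms of order \<open>\<eta>\<^sup>2\<close> in one step. The factor 4 is
  the 2 of the cross term times the 2 in the diameter \<open>2 * R\<close>.\<close>

definition defect :: "real \<Rightarrow> real" where
  "defect R = 4 * \<Lambda> * R * noise R + (noise R)\<^sup>2"

lemma \<Lambda>_pos: "\<Lambda> > 0"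
  using \<alpha>_pos \<alpha>_le by simp

lemma g0_nonneg: "g0 \<ge> 0"
  using order_trans[OF norm_ge_zero bound_at_0[of 1]] N_pos by simp

lemma step_size:
  assumes "0 < \<eta>" "\<eta> < \<alpha> / \<Lambda>\<^sup>2"
  shows "\<eta> * \<Lambda>\<^sup>2 \<le> \<alpha>" "\<eta> * \<alpha> \<le> 1"
proof -
  show *: "\<eta> * \<Lambda>\<^sup>2 \<le> \<alpha>"
    using assms \<Lambda>_pos by (simp add: field_simps)
  have "\<alpha> * (\<eta> * \<alpha>) = \<eta> * \<alpha>\<^sup>2" by (simp add: power2_eq_square)
  also have "\<dots> \<le> \<eta> * \<Lambda>\<^sup>2"
    using \<alpha>_pos \<alpha>_le assms by (intro mult_left_mono power_mono) auto
  also have "\<dots> \<le> \<alpha> * 1" using * by simp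
  finally show "\<eta> * \<alpha> \<le> 1" using \<alpha>_pos by simp
qed

text \<open>Expanding the square, strong monotonicity gains \<open>2 * \<eta> * \<alpha>\<close>,
  while the Lipschitz bound loses \<open>\<eta>\<^sup>2 * \<Lambda>\<^sup>2\<close>, which the
  step-size restriction keeps below \<open>\<eta> * \<alpha>\<close>.\<close>

lemma step_contraction:
  assumes "0 < \<eta>" "\<eta> < \<alpha> / \<Lambda>\<^sup>2" and k: "k \<in> {1..N}"
  shows "(norm (step \<eta> k u - step \<eta> k v))\<^sup>2 \<le> (1 - \<eta> * \<alpha>) * (norm (u - v))\<^sup>2"
proof -
  let ?d = "u - v" and ?D = "G k u - G k v"
  have eq: "step \<eta> k u - step \<eta> k v = ?d - \<eta> *\<^sub>R ?D"
    by (simp add: step_def algebra_simps)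
  have "(norm (step \<eta> k u - step \<eta> k v))\<^sup>2 = (norm ?d)\<^sup>2 - 2 * \<eta> * (?D \<bullet> ?d) + \<eta>\<^sup>2 * (norm ?D)\<^sup>2"
    unfolding eq using norm_add_scaleR_power2[of ?d "- \<eta>" ?D] by (simp add: inner_commute)
  also have "\<dots> \<le> (norm ?d)\<^sup>2 - 2 * \<eta> * (\<alpha> * (norm ?d)\<^sup>2) + \<eta>\<^sup>2 * (\<Lambda> * norm ?d)\<^sup>2"
    using strong_mono[OF k, of u v] lipschitz[OF k, of u v] assms(1)
    by (intro add_mono diff_mono mult_left_mono power_mono) auto
  also have "\<dots> = (norm ?d)\<^sup>2 - 2 * \<eta> * \<alpha> * (norm ?d)\<^sup>2 + \<eta> * (\<eta> * \<Lambda>\<^sup>2) * (norm ?d)\<^sup>2"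
    by (simp add: power2_eq_square algebra_simps)
  also have "\<dots> \<le> (norm ?d)\<^sup>2 - 2 * \<eta> * \<alpha> * (norm ?d)\<^sup>2 + \<eta> * \<alpha> * (norm ?d)\<^sup>2"
    using step_size(1)[OF assms(1,2)] assms(1)
    by (intro add_left_mono mult_right_mono mult_left_mono) auto
  finally show ?thesis by (simp add: algebra_simps)
qed

lemma step_norm_le_radius:
  assumes \<eta>: "0 < \<eta>" "\<eta> < \<alpha> / \<Lambda>\<^sup>2" and k: "k \<in> {1..N}" and u: "norm u \<le> radius s"
  shows "norm (step \<eta> k u) \<le> radius s"
proof -
  have half: "0 \<le> 1 - \<eta> * \<alpha> / 2"
    using step_size(2)[OF \<eta>] by simp
  have "(norm (step \<eta> k u - step \<eta> k 0))\<^sup>2 \<le> (1 - \<eta> * \<alpha>) * (norm u)\<^sup>2"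
    using step_contraction[OF \<eta> k, of u 0] by simp
  \<comment> \<open>Completing the square turns the contraction of squared norms into one of norms
    with factor \<open>1 - \<eta> * \<alpha> / 2\<close>.\<close>
  also have "\<dots> \<le> (1 - \<eta> * \<alpha> / 2)\<^sup>2 * (norm u)\<^sup>2"
  proof (rule mult_right_mono)
    have "(1 - \<eta> * \<alpha> / 2)\<^sup>2 = 1 - \<eta> * \<alpha> + (\<eta> * \<alpha> / 2)\<^sup>2"
      by (simp add: power2_eq_square field_simps)
    then show "1 - \<eta> * \<alpha> \<le> (1 - \<eta> * \<alpha> / 2)\<^sup>2" by simp
  qed simp
  finally have "(norm (step \<eta> k u - step \<eta> k 0))\<^sup>2 \<le> ((1 - \<eta> * \<alpha> / 2) * norm u)\<^sup>2"
    by (simp only: power_mult_distrib)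
  then have "norm (step \<eta> k u - step \<eta> k 0) \<le> (1 - \<eta> * \<alpha> / 2) * norm u"
    by (rule power2_le_imp_le) (rule mult_nonneg_nonneg[OF half norm_ge_zero])
  moreover have "norm (step \<eta> k 0) \<le> \<eta> * g0"
    using bound_at_0[OF k] \<eta> by (simp add: step_def)
  moreover have "norm (step \<eta> k u) \<le> norm (step \<eta> k u - step \<eta> k 0) + norm (step \<eta> k 0)"
    using norm_triangle_ineq[of "step \<eta> k u - step \<eta> k 0" "step \<eta> k 0"] by simp
  moreover have "(1 - \<eta> * \<alpha> / 2) * norm u \<le> (1 - \<eta> * \<alpha> / 2) * radius s"
    using u half by (rule mult_left_mono)
  ultimately have "norm (step \<eta> k u) \<le> radius s - \<eta> * (\<alpha> / 2 * radius s) + \<eta> * g0"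
    by (simp add: algebra_simps)
  also have "\<dots> \<le> radius s - \<eta> * g0 + \<eta> * g0"
  proof -
    have "g0 \<le> \<alpha> / 2 * radius s"
      using \<alpha>_pos by (simp add: radius_def distrib_left)
    then show ?thesis using \<eta> by simp
  qed
  finally show ?thesis by simp
qed

text \<open>Through this average, the invariance of the ball under every
  \<open>step \<eta> k\<close> passes to \<open>mean_step \<eta>\<close>.\<close>

lemma mean_step_eq: "mean_step \<eta> u = (\<Sum>k=1..N. step \<eta> k u) /\<^sub>R real N"
  using N_pos by (simp add: mean_step_def mean_field_def step_def sum_subtractf scaleR_diff_right
      scaleR_sum_right sum_constant_scaleR mult.commute)

lemma norm_average_le:
  assumes "\<And>k. k \<in> {1..N} \<Longrightarrow> norm (f k :: 'a) \<le> B"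
  shows "norm ((\<Sum>k=1..N. f k) /\<^sub>R real N) \<le> B"
  using sum_norm_bound[of "{1..N}" f B] assms N_pos by (simp add: field_simps)

lemma mean_step_norm_le_radius:
  assumes "0 < \<eta>" "\<eta> < \<alpha> / \<Lambda>\<^sup>2" and "norm u \<le> radius s"
  shows "norm (mean_step \<eta> u) \<le> radius s"
  unfolding mean_step_eq using step_norm_le_radius assms by (intro norm_average_le) auto

lemma norm_G_le:
  assumes k: "k \<in> {1..N}" and u: "norm u \<le> R"
  shows "norm (G k u) \<le> \<Lambda> * R + g0"
proof -
  have "norm (G k u) \<le> norm (G k u - G k 0) + norm (G k 0)"
    using norm_triangle_ineq[of "G k u - G k 0" "G k 0"] by simp
  also have "\<dots> \<le> \<Lambda> * norm u + g0"
    using lipschitz[OF k, of u 0] bound_at_0[OF k] by simp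
  also have "\<dots> \<le> \<Lambda> * R + g0"
    using u \<Lambda>_pos by simp
  finally show ?thesis .
qed

text \<open>The noise \<open>mean_field c - G k c\<close> averages to \<open>0\<close> over \<open>k\<close>; its pairing with \<open>u - c\<close> is thus
  cancelled and only its pairing with the \<open>\<eta>\<close>-small part of the increment remains.\<close>

lemma averaged_step_deviation:
  assumes \<eta>: "0 < \<eta>" "\<eta> < \<alpha> / \<Lambda>\<^sup>2" and u: "norm u \<le> R" and c: "norm c \<le> R"
  shows "(\<Sum>k=1..N. (norm (step \<eta> k u - mean_step \<eta> c))\<^sup>2) / real N
    \<le> (1 - \<eta> * \<alpha>) * (norm (u - c))\<^sup>2 + \<eta>\<^sup>2 * defect R"
proof -
  define z where "z k = mean_field c - G k c" for k
  have z_sum: "(\<Sum>k=1..N. z k) = 0"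
    using N_pos by (simp add: z_def mean_field_def sum_subtractf sum_constant_scaleR)
  have z_le: "norm (z k) \<le> noise R" if "k \<in> {1..N}" for k
  proof -
    have "norm (mean_field c) \<le> \<Lambda> * R + g0"
      unfolding mean_field_def using norm_G_le[OF _ c] by (rule norm_average_le)
    then show ?thesis
      using norm_G_le[OF that c] norm_triangle_ineq4[of "mean_field c" "G k c"]
      by (simp add: z_def noise_def)
  qed
  have R: "R \<ge> 0" using u norm_ge_zero order_trans by blast
  have summand: "(norm (step \<eta> k u - mean_step \<eta> c))\<^sup>2
      \<le> (1 - \<eta> * \<alpha>) * (norm (u - c))\<^sup>2 + \<eta>\<^sup>2 * defect R + 2 * \<eta> * ((u - c) \<bullet> z k)"
    if k: "k \<in> {1..N}" for k
  proof -
    let ?q = "step \<eta> k u - step \<eta> k c" and ?D = "G k u - G k c"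
    have "step \<eta> k u - mean_step \<eta> c = ?q + \<eta> *\<^sub>R z k"
      by (simp add: step_def mean_step_def z_def algebra_simps)
    then have "(norm (step \<eta> k u - mean_step \<eta> c))\<^sup>2
        = (norm ?q)\<^sup>2 + 2 * \<eta> * (?q \<bullet> z k) + \<eta>\<^sup>2 * (norm (z k))\<^sup>2"
      by (simp only: norm_add_scaleR_power2)
    also have "?q \<bullet> z k = (u - c) \<bullet> z k - \<eta> * (?D \<bullet> z k)"
      by (simp add: step_def inner_diff_left algebra_simps)
    finally have eq: "(norm (step \<eta> k u - mean_step \<eta> c))\<^sup>2 = (norm ?q)\<^sup>2
        + 2 * \<eta> * ((u - c) \<bullet> z k) + \<eta>\<^sup>2 * (2 * - (?D \<bullet> z k) + (norm (z k))\<^sup>2)"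
      by (simp add: power2_eq_square algebra_simps)
    have "norm (u - c) \<le> 2 * R"
      using norm_triangle_ineq4[of u c] u c by simp
    then have "\<Lambda> * norm (u - c) \<le> \<Lambda> * (2 * R)"
      using \<Lambda>_pos by (intro mult_left_mono) auto
    then have "norm ?D \<le> \<Lambda> * (2 * R)"
      by (rule order_trans[OF lipschitz[OF k]])
    then have "norm ?D * norm (z k) \<le> \<Lambda> * (2 * R) * noise R"
      using z_le[OF k] R \<Lambda>_pos by (intro mult_mono) auto
    moreover have "- (?D \<bullet> z k) \<le> norm ?D * norm (z k)"
      using Cauchy_Schwarz_ineq2[of ?D "z k"] by simp
    moreover have "(norm (z k))\<^sup>2 \<le> (noise R)\<^sup>2"
      using z_le[OF k] by (rule power_mono) simp
    ultimately have "2 * - (?D \<bullet> z k) + (norm (z k))\<^sup>2 \<le> defect R"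
      by (simp add: defect_def)
    from mult_left_mono[OF this, of "\<eta>\<^sup>2"] step_contraction[OF \<eta> k, of u c]
    show ?thesis unfolding eq by simp
  qed
  have "(\<Sum>k=1..N. (norm (step \<eta> k u - mean_step \<eta> c))\<^sup>2)
      \<le> (\<Sum>k=1..N. (1 - \<eta> * \<alpha>) * (norm (u - c))\<^sup>2 + \<eta>\<^sup>2 * defect R + 2 * \<eta> * ((u - c) \<bullet> z k))"
    using summand by (rule sum_mono)
  also have "\<dots> = real N * ((1 - \<eta> * \<alpha>) * (norm (u - c))\<^sup>2 + \<eta>\<^sup>2 * defect R)"
    using z_sum by (simp add: sum.distrib sum_distrib_left[symmetric] inner_sum_right[symmetric])
  finally show ?thesis
    using N_pos by (simp add: field_simps)
qed

section \<open>Bounds uniform in the number of steps\<close>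

lemma mean_orbit_norm_le:
  assumes \<eta>: "0 < \<eta>" "\<eta> < \<alpha> / \<Lambda>\<^sup>2"
  shows "norm ((mean_step \<eta> ^^ n) s) \<le> radius s"
proof (induction n)
  case 0
  show ?case using g0_nonneg \<alpha>_pos by (simp add: radius_def)
next
  case (Suc n)
  then show ?case using mean_step_norm_le_radius[OF \<eta>] by simp
qed

lemma orbit_norm_le:
  assumes \<eta>: "0 < \<eta>" "\<eta> < \<alpha> / \<Lambda>\<^sup>2" and g: "\<And>i. g i \<in> {1..N}"
  shows "norm (orbit (step \<eta>) s g n) \<le> radius s"
proof (induction n)
  case 0
  show ?case using g0_nonneg \<alpha>_pos by (simp add: radius_def)
next
  case (Suc n)
  then show ?case using step_norm_le_radius[OF \<eta> g] by simp
qed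

lemma continuous_step:
  assumes k: "k \<in> {1..N}"
  shows "continuous_on UNIV (step \<eta> k)"
proof -
  have "\<Lambda>-lipschitz_on UNIV (G k)"
    using lipschitz[OF k] \<Lambda>_pos by (intro lipschitz_onI) (auto simp: dist_norm)
  then have "continuous_on UNIV (G k)" by (rule lipschitz_on_continuous_on)
  then show ?thesis
    unfolding step_def[abs_def] by (intro continuous_intros)
qed

text \<open>With \<open>K\<close> the defect at \<open>radius s\<close>, the bound
  \<open>K / \<alpha> * \<eta>\<close> is the fixed point of the recursion
  \<open>r \<mapsto> (1 - \<eta> * \<alpha>) * r + \<eta>\<^sup>2 * K\<close>, so the induction
  reproduces it exactly.\<close>

lemma orbit_mean_square_deviation:
  assumes iid: "iid_uniform_indices M N \<gamma>" and \<eta>: "0 < \<eta>" "\<eta> < \<alpha> / \<Lambda>\<^sup>2"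
  shows "(LINT \<omega>|M. (norm (orbit (step \<eta>) s (\<lambda>j. \<gamma> j \<omega>) n - (mean_step \<eta> ^^ n) s))\<^sup>2)
    \<le> defect (radius s) / \<alpha> * \<eta>"
proof (induction n)
  case 0
  \<comment> \<open>Both orbits start at \<open>s\<close>, so the deviation is 0 and only the sign
    of the bound is at stake.\<close>
  have "radius s \<ge> 0"
    using g0_nonneg \<alpha>_pos by (simp add: radius_def)
  then have "noise (radius s) \<ge> 0"
    using g0_nonneg \<Lambda>_pos by (simp add: noise_def)
  with \<open>radius s \<ge> 0\<close> have "defect (radius s) \<ge> 0"
    using \<Lambda>_pos by (simp add: defect_def)
  then show ?case using \<alpha>_pos \<eta> by simp
next
  case (Suc n)
  interpret prob_space M using iid by (simp add: iid_uniform_indices_def)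
  let ?S = "\<lambda>\<omega>. orbit (step \<eta>) s (\<lambda>j. \<gamma> j \<omega>) n" and ?c = "(mean_step \<eta> ^^ n) s"
  let ?K = "defect (radius s)"
  have T: "step \<eta> k \<in> borel_measurable borel" if "k \<in> {1..N}" for k
    using continuous_step[OF that] by (rule borel_measurable_continuous_onI)
  note range = iid_uniform_indices_range[OF iid]
  have S_meas: "?S \<in> borel_measurable M"
    using iid T by (rule iid_uniform_indices_orbit_measurable)
  have S_le: "norm (?S \<omega>) \<le> radius s" if "\<omega> \<in> space M" for \<omega>
    using orbit_norm_le[OF \<eta>] range that by simp
  have int: "integrable M (\<lambda>\<omega>. F (?S \<omega>))" if "continuous_on UNIV F" for F :: "'a \<Rightarrow> real"
    using S_meas S_le that by (rule integrable_continuous_of_bounded)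
  have cont: "continuous_on UNIV (\<lambda>u. (norm (step \<eta> k u - mean_step \<eta> ?c))\<^sup>2)" if "k \<in> {1..N}" for k
    using continuous_step[OF that] by (intro continuous_intros)
  have cont': "continuous_on UNIV (\<lambda>u. (norm (u - ?c))\<^sup>2)"
    by (intro continuous_intros)
  have "(LINT \<omega>|M. (norm (orbit (step \<eta>) s (\<lambda>j. \<gamma> j \<omega>) (Suc n) - (mean_step \<eta> ^^ Suc n) s))\<^sup>2) =
      (LINT \<omega>|M. (\<Sum>k=1..N. (norm (step \<eta> k (?S \<omega>) - mean_step \<eta> ?c))\<^sup>2) / real N)"
    using expectation_orbit_Suc[where T = "step \<eta>" and F = "\<lambda>u. (norm (u - mean_step \<eta> ?c))\<^sup>2",
        OF iid T _ int[OF cont]]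
    by simp
  also have "\<dots> \<le> (LINT \<omega>|M. (1 - \<eta> * \<alpha>) * (norm (?S \<omega> - ?c))\<^sup>2 + \<eta>\<^sup>2 * ?K)"
    using int[OF cont] int[OF cont'] averaged_step_deviation[OF \<eta> S_le mean_orbit_norm_le[OF \<eta>]]
    by (intro integral_mono integrable_divide Bochner_Integration.integrable_sum) auto
  also have "\<dots> = (1 - \<eta> * \<alpha>) * (LINT \<omega>|M. (norm (?S \<omega> - ?c))\<^sup>2) + \<eta>\<^sup>2 * ?K"
    using int[OF cont'] by (simp add: prob_space)
  \<comment> \<open>The induction hypothesis may be inserted because
    \<open>1 - \<eta> * \<alpha>\<close> is nonnegative.\<close>
  also have "\<dots> \<le> (1 - \<eta> * \<alpha>) * (?K / \<alpha> * \<eta>) + \<eta>\<^sup>2 * ?K"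
    using Suc.IH step_size(2)[OF \<eta>] by (intro add_right_mono mult_left_mono) auto
  also have "\<dots> = ?K / \<alpha> * \<eta>"
    using \<alpha>_pos by (simp add: field_simps power2_eq_square)
  finally show ?case .
qed

end

section \<open>Quadratic forms of the covariance matrix\<close>

lemma quadratic_form_cov_matrix:
  fixes e :: "'w \<Rightarrow> real^'i"
  assumes "prob_space M" and e: "e \<in> borel_measurable M"
    and bd: "\<And>\<omega>. \<omega> \<in> space M \<Longrightarrow> norm (e \<omega>) \<le> R"
  shows "x \<bullet> (cov_matrix M e e *v x) = (LINT \<omega>|M. (x \<bullet> (e \<omega> - integral\<^sup>L M e))\<^sup>2)"
proof -
  interpret prob_space M by fact
  let ?m = "integral\<^sup>L M e"
  let ?P = "\<lambda>v. (columnvector (v - ?m) :: real^1^'i) ** (rowvector (v - ?m) :: real^'i^1)"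
  have P_nth: "?P v = (\<chi> i j. (v - ?m) $ i * (v - ?m) $ j)" for v
    by (simp add: vec_eq_iff columnvector_rowvector_nth)
  have "continuous_on UNIV ?P"
    unfolding P_nth by (intro continuous_intros)
  \<comment> \<open>Integrability of the matrix rules out the default value 0 of the integral and
    lets the linear functional below pass inside it.\<close>
  then have int: "integrable M (\<lambda>\<omega>. ?P (e \<omega>))"
    using e bd by (intro integrable_continuous_of_bounded)
  have "linear (\<lambda>B :: real^'i^'i. x \<bullet> (B *v x))"
    by (intro linearI) (simp_all add: matrix_vector_mult_add_rdistrib inner_add_right
        scaleR_matrix_vector_assoc[symmetric])
  then have bl: "bounded_linear (\<lambda>B :: real^'i^'i. x \<bullet> (B *v x))"
    by (simp add: linear_conv_bounded_linear)
  have "x \<bullet> (cov_matrix M e e *v x) = (LINT \<omega>|M. x \<bullet> (?P (e \<omega>) *v x))"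
    unfolding cov_matrix_def by (rule integral_bounded_linear[OF bl int, symmetric])
  moreover have "x \<bullet> (?P v *v x) = (x \<bullet> (v - ?m))\<^sup>2" for v
  proof -
    have "?P v *v x = (x \<bullet> (v - ?m)) *\<^sub>R (v - ?m)"
      unfolding P_nth vec_eq_iff
      by (simp add: matrix_vector_mult_def inner_vec_def sum_distrib_left sum_distrib_right mult_ac)
    then show ?thesis by (simp add: power2_eq_square)
  qed
  ultimately show ?thesis by simp
qed

text \<open>The variance of \<open>x \<bullet> e\<close> is unchanged by a shift, so it is at most
  the second moment about any deterministic \<open>a\<close>; Cauchy-Schwarz with a unit
  \<open>x\<close> finishes. The free centre \<open>a\<close> will be the deterministic descent
  relative to the minimizer.\<close>

lemma quadratic_form_cov_matrix_le:
  fixes e :: "'w \<Rightarrow> real^'i"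
  assumes M: "prob_space M" and e: "e \<in> borel_measurable M"
    and bd: "\<And>\<omega>. \<omega> \<in> space M \<Longrightarrow> norm (e \<omega>) \<le> R" and x: "norm x = 1"
  shows "x \<bullet> (cov_matrix M e e *v x) \<le> (LINT \<omega>|M. (norm (e \<omega> - a))\<^sup>2)"
proof -
  interpret prob_space M by fact
  let ?Y = "\<lambda>\<omega>. x \<bullet> (e \<omega> - a)"
  have int: "integrable M (\<lambda>\<omega>. F (e \<omega>))" if "continuous_on UNIV F"
    for F :: "real^'i \<Rightarrow> 'c::euclidean_space"
    using e bd that by (rule integrable_continuous_of_bounded)
  have intE: "integrable M e" using int[of "\<lambda>u. u"] by simp
  have intY: "integrable M ?Y" "integrable M (\<lambda>\<omega>. (?Y \<omega>)\<^sup>2)"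
    by (rule int, intro continuous_intros)+
  have "integral\<^sup>L M ?Y = x \<bullet> (integral\<^sup>L M e - a)"
    using intE by (simp add: prob_space)
  then have "x \<bullet> (cov_matrix M e e *v x) = (LINT \<omega>|M. (?Y \<omega> - integral\<^sup>L M ?Y)\<^sup>2)"
    by (simp add: quadratic_form_cov_matrix[OF M e bd] inner_diff_right)
  also have "\<dots> \<le> (LINT \<omega>|M. (?Y \<omega>)\<^sup>2)"
    by (rule variance_le_second_moment[OF intY])
  also have "\<dots> \<le> (LINT \<omega>|M. (norm (e \<omega> - a))\<^sup>2)"
  proof (rule integral_mono[OF intY(2)])
    show "integrable M (\<lambda>\<omega>. (norm (e \<omega> - a))\<^sup>2)"
      by (rule int) (intro continuous_intros)
    show "(?Y \<omega>)\<^sup>2 \<le> (norm (e \<omega> - a))\<^sup>2" for \<omega>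
      using power_mono[OF Cauchy_Schwarz_ineq2[of x "e \<omega> - a"] abs_ge_zero, of 2] x by simp
  qed
  finally show ?thesis .
qed

section \<open>The regularized least-squares problem\<close>

theorem theorem3:
  fixes N :: nat
    and A :: "nat \<Rightarrow> real^'x^'p"
    and b :: "nat \<Rightarrow> real^'p"
    and \<alpha> :: real
    and \<sigma>0 \<sigma>star :: "real^'x"
  assumes "N \<ge> 1"
    and "\<alpha> > 0"
    and "is_arg_min (objective N A b \<alpha>) (\<lambda>_. True) \<sigma>star"
  shows "\<exists>\<eta>bar > 0. \<exists>C > 0.
           \<forall>(M :: 'w measure) \<gamma>. iid_uniform_indices M N \<gamma> \<longrightarrow>
             (\<forall>\<eta> n. 0 < \<eta> \<and> \<eta> < \<eta>bar \<longrightarrow>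
               (let e = (\<lambda>\<omega>. sgd A b \<alpha> \<eta> \<sigma>0 (\<lambda>j. \<gamma> j \<omega>) n - \<sigma>star) in
                  \<forall>x :: real^'x. norm x = 1 \<longrightarrow> x \<bullet> (cov_matrix M e e *v x) \<le> C * \<eta>))"
proof -
  define H where "H k = transpose (A k) ** A k" for k
  define G where "G k \<sigma> = H k *v \<sigma> - transpose (A k) *v b k + \<alpha> *\<^sub>R \<sigma>" for k \<sigma>
  \<comment> \<open>The sum of the operator norms dominates each of them, giving one Lipschitz
    constant for all \<open>k\<close>; the summand \<alpha> accounts for the regularization and
    gives \<open>\<alpha> \<le> \<Lambda>\<close>.\<close>
  define \<Lambda> where "\<Lambda> = \<alpha> + (\<Sum>k=1..N. onorm ((*v) (H k)))"
  define g0 where "g0 = (\<Sum>k=1..N. norm (G k 0))"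
  have onorm_nonneg: "0 \<le> onorm ((*v) (H k))" for k
    by (simp add: onorm_pos_le matrix_vector_mul_bounded_linear)
  have G_diff: "G k u - G k v = H k *v (u - v) + \<alpha> *\<^sub>R (u - v)" for k u v
    by (simp add: G_def matrix_vector_mult_diff_distrib algebra_simps)
  \<comment> \<open>Each \<open>H k\<close> is positive semidefinite, so \<alpha> is a strong
    monotonicity constant for every \<open>G k\<close>.\<close>
  have H_inner: "(H k *v v) \<bullet> v = (norm (A k *v v))\<^sup>2" for k v
    by (simp add: H_def matrix_vector_mul_assoc[symmetric] power2_norm_eq_inner
        dot_lmul_matrix[symmetric] inner_commute transpose_matrix_vector)
  interpret strongly_monotone_family N G \<alpha> \<Lambda> g0
  proof
    show "\<alpha> \<le> \<Lambda>" using onorm_nonneg by (simp add: \<Lambda>_def sum_nonneg)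
    fix k u v assume k: "k \<in> {1..N}"
    show "\<alpha> * (norm (u - v))\<^sup>2 \<le> (G k u - G k v) \<bullet> (u - v)"
      unfolding G_diff by (simp add: inner_add_left H_inner power2_norm_eq_inner)
    show "norm (G k 0) \<le> g0"
      unfolding g0_def using k by (intro member_le_sum) auto
    have "onorm ((*v) (H k)) \<le> \<Lambda> - \<alpha>"
      unfolding \<Lambda>_def using k onorm_nonneg member_le_sum[of k "{1..N}" "\<lambda>k. onorm ((*v) (H k))"] by simp
    then have "norm (H k *v w) \<le> (\<Lambda> - \<alpha>) * norm w" for w
      using onorm[OF matrix_vector_mul_bounded_linear, of "H k" w] mult_right_mono
      by (meson norm_ge_zero order_trans)
    then have "norm (H k *v w) + norm (\<alpha> *\<^sub>R w) \<le> \<Lambda> * norm w" for w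
      using \<open>\<alpha> > 0\<close> by (simp add: left_diff_distrib le_diff_eq)
    then show "norm (G k u - G k v) \<le> \<Lambda> * norm (u - v)"
      unfolding G_diff by (rule norm_triangle_le)
  qed fact+
  have sgd_eq: "sgd A b \<alpha> \<eta> s g n = orbit (step \<eta>) s g n" for \<eta> s g n
  proof (induction n)
    case (Suc n)
    then show ?case
      by (simp only: sgd.simps orbit.simps Let_def step_def) (simp only: G_def H_def)
  qed simp
  \<comment> \<open>\<open>C\<close> depends only on the data and \<open>\<sigma>0\<close>, and is
    fixed before \<open>M\<close>, \<open>\<gamma>\<close>, \<open>\<eta>\<close> and
    \<open>n\<close>. The absolute value and the added 1 make it positive.\<close>
  define C where "C = \<bar>defect (radius \<sigma>0)\<bar> / \<alpha> + 1"
  have main: "x \<bullet> (cov_matrix M e e *v x) \<le> C * \<eta>"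
    if iid: "iid_uniform_indices M N \<gamma>" and \<eta>: "0 < \<eta>" "\<eta> < \<alpha> / \<Lambda>\<^sup>2" and x: "norm x = 1"
      and e: "e = (\<lambda>\<omega>. sgd A b \<alpha> \<eta> \<sigma>0 (\<lambda>j. \<gamma> j \<omega>) n - \<sigma>star)"
    for M :: "'w measure" and \<gamma> \<eta> n x e
  proof -
    have M: "prob_space M" using iid by (simp add: iid_uniform_indices_def)
    have T: "step \<eta> k \<in> borel_measurable borel" if "k \<in> {1..N}" for k
      using continuous_step[OF that] by (rule borel_measurable_continuous_onI)
    have e_meas: "e \<in> borel_measurable M"
      unfolding e sgd_eq using iid_uniform_indices_orbit_measurable[OF iid, of "step \<eta>" \<sigma>0 n] T
      by simp
    have e_le: "norm (e \<omega>) \<le> radius \<sigma>0 + norm \<sigma>star" if "\<omega> \<in> space M" for \<omega>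
      using orbit_norm_le[OF \<eta>, of "\<lambda>j. \<gamma> j \<omega>" \<sigma>0 n] iid_uniform_indices_range[OF iid that]
        norm_triangle_ineq4[of "e \<omega> + \<sigma>star" \<sigma>star]
      by (simp add: e sgd_eq)
    \<comment> \<open>With this centre \<open>\<sigma>star\<close> cancels, and the deviation is
      that of the random iterate from the deterministic one.\<close>
    have "x \<bullet> (cov_matrix M e e *v x)
        \<le> (LINT \<omega>|M. (norm (e \<omega> - ((mean_step \<eta> ^^ n) \<sigma>0 - \<sigma>star)))\<^sup>2)"
      by (rule quadratic_form_cov_matrix_le[OF M e_meas e_le x])
    also have "\<dots> \<le> defect (radius \<sigma>0) / \<alpha> * \<eta>"
      using orbit_mean_square_deviation[OF iid \<eta>, of \<sigma>0 n] by (simp add: e sgd_eq)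
    also have "\<dots> \<le> C * \<eta>"
    proof -
      have "defect (radius \<sigma>0) / \<alpha> \<le> \<bar>defect (radius \<sigma>0)\<bar> / \<alpha>"
        using \<alpha>_pos by (intro divide_right_mono) auto
      then show ?thesis
        unfolding C_def using \<eta> by (intro mult_right_mono) auto
    qed
    finally show ?thesis .
  qed
  have "\<alpha> / \<Lambda>\<^sup>2 > 0" "C > 0"
    using \<alpha>_pos \<Lambda>_pos by (auto simp: C_def intro!: add_nonneg_pos)
  with main show ?thesis
    unfolding Let_def by blast
qed

end
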